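(* Let $k\ge 3$ be an integer. (a) There exists a constant $c_k>0$ such that with probability tending to $1$ as $n\to\infty$, $f^*(k,2,n)\ge (c_k+\tfrac12)n$. (b) There is a function $\varepsilon(n)\to 0$ such that with probability tending to $1$ as $n\to\infty$, $$\frac{f^*(k,n)}{n}-\varepsilon(n)\le\begin{cases}\frac12+\frac{1}{4\cdot 3^{k/3-1}} & \text{if } k\equiv 0 \pmod 3,\\ \frac12+\frac{1}{2\cdot 3^{(k-1)/3}} & \text{if } k\equiv 1 \pmod 3,\\ \frac12+\frac{1}{8\cdot 3^{(k-5)/3}} & \text{if } k\equiv 2 \pmod 3.\end{cases}$$
   Context: A tournament is an orientation of a complete graph. An arborescence is an oriented tree with a designated root such that every vertex of the tree is reachable from the root by a directed path in the tree; its depth is the length of a longest directed path in it. An edge-colored arborescence is path-monochromatic if every directed path in it is monochromatic. A $k$-edge coloring is an arbitrary assignment of one of $k$ colors to each edge. For a tournament $T$, $f_T(k,\ell)$ is the largest integer $m$ such that every $k$-edge coloring of $T$ contains a path-monochromatic arborescence of depth at most $\ell$ with at least $m$ vertices, and $f_T(k)$ is the same without depth restriction. A random tournament $T\sim\mathcal T_n$ is the tournament on vertex set $[n]$ where each edge is oriented independently by a fair coin flip. $f^*(k,\ell,n)$ and $f^*(k,n)$ denote the random variables $f_T(k,\ell)$ and $f_T(k)$ for $T\sim\mathcal T_n$. *)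

theory Defs
  imports "HOL-Probability.Product_PMF" "Graph_Theory.Pair_Digraph" "Graph_Theory.Digraph_Component"
begin

definition tournament :: "'a pair_pre_digraph \<Rightarrow> bool" where
  "tournament T \<longleftrightarrow> pair_digraph T \<and>
     (\<forall>u\<in>pverts T. \<forall>v\<in>pverts T. u \<noteq> v \<longrightarrow> ((u, v) \<in> parcs T \<longleftrightarrow> (v, u) \<notin> parcs T))"

text \<open>
  The library predicate \<^const>\<open>tree\<close> only excludes directed cycles. An oriented tree has no cycle in
  its underlying undirected graph; in the symmetric closure every edge yields a closed walk of
  length two, so the cycles of the underlying graph are the library cycles of length at least three.
\<close>
definition oriented_tree :: "'a pair_pre_digraph \<Rightarrow> bool" where
  "oriented_tree H \<longleftrightarrow> pair_digraph H \<and> asym (parcs H) \<and> connected (with_proj H) \<and>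
     (\<nexists>p. pre_digraph.cycle (with_proj (mk_symmetric (with_proj H))) p \<and> 3 \<le> length p)"

definition arborescence :: "'a pair_pre_digraph \<Rightarrow> 'a \<Rightarrow> bool" where
  "arborescence H r \<longleftrightarrow> oriented_tree H \<and> r \<in> pverts H \<and>
     (\<forall>v\<in>pverts H. \<exists>p. pre_digraph.apath (with_proj H) r p v)"

definition depth :: "'a pair_pre_digraph \<Rightarrow> nat" where
  "depth H = Max {length p | u p v. pre_digraph.apath (with_proj H) u p v}"

definition path_monochromatic :: "('a \<times> 'a \<Rightarrow> nat) \<Rightarrow> 'a pair_pre_digraph \<Rightarrow> bool" where
  "path_monochromatic c H \<longleftrightarrow>
     (\<forall>u p v. pre_digraph.apath (with_proj H) u p v \<longrightarrow> (\<forall>e\<in>set p. \<forall>e'\<in>set p. c e = c e'))"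

definition edge_coloring :: "nat \<Rightarrow> 'a pair_pre_digraph \<Rightarrow> ('a \<times> 'a \<Rightarrow> nat) \<Rightarrow> bool" where
  "edge_coloring k T c \<longleftrightarrow> c \<in> parcs T \<rightarrow> {1..k}"

definition f_depth :: "'a pair_pre_digraph \<Rightarrow> nat \<Rightarrow> nat \<Rightarrow> nat" where
  "f_depth T k l = (GREATEST m. \<forall>c. edge_coloring k T c \<longrightarrow>
     (\<exists>H r. subgraph (with_proj H) (with_proj T) \<and> arborescence H r \<and> path_monochromatic c H \<and>
        depth H \<le> l \<and> m \<le> card (pverts H)))"

definition f_unbounded :: "'a pair_pre_digraph \<Rightarrow> nat \<Rightarrow> nat" where
  "f_unbounded T k = (GREATEST m. \<forall>c. edge_coloring k T c \<longrightarrow>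
     (\<exists>H r. subgraph (with_proj H) (with_proj T) \<and> arborescence H r \<and> path_monochromatic c H \<and>
        m \<le> card (pverts H)))"

text \<open>One fair coin per pair \<open>i < j\<close>; heads orients the edge from \<open>i\<close> to \<open>j\<close>.\<close>
definition tournament_of_coins :: "nat \<Rightarrow> (nat \<times> nat \<Rightarrow> bool) \<Rightarrow> nat pair_pre_digraph" where
  "tournament_of_coins n x =
     \<lparr>pverts = {1..n},
      parcs = {(i, j). i \<in> {1..n} \<and> j \<in> {1..n} \<and> (i < j \<and> x (i, j) \<or> j < i \<and> \<not> x (j, i))}\<rparr>"

definition random_tournament :: "nat \<Rightarrow> nat pair_pre_digraph pmf" where
  "random_tournament n = map_pmf (tournament_of_coins n)
     (Pi_pmf {(i, j). 1 \<le> i \<and> i < j \<and> j \<le> n} False (\<lambda>_. bernoulli_pmf (1/2)))"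

lemma tournament_tournament_of_coins: "tournament (tournament_of_coins n x)"
proof -
  have "parcs (tournament_of_coins n x) \<subseteq> {1..n} \<times> {1..n}"
    by (auto simp: tournament_of_coins_def)
  then have "finite (parcs (tournament_of_coins n x))"
    by (rule finite_subset) simp
  then have "pair_digraph (tournament_of_coins n x)"
    by unfold_locales (auto simp: tournament_of_coins_def)
  then show ?thesis
    by (auto simp: tournament_def tournament_of_coins_def)
qed

lemma tournament_random_tournament: "T \<in> set_pmf (random_tournament n) \<Longrightarrow> tournament T"
  by (auto simp: random_tournament_def tournament_tournament_of_coins)

end

theory Submission
  imports Defs "HOL-Probability.Hoeffding" "HOL-Real_Asymp.Real_Asymp"
begin

text \<open>
  (a) By Hoeffding's inequality and a union bound over all \<open>A\<close>, \<open>B\<close>, a random tournament has about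
  \<open>|A||B|/2\<close> arcs from \<open>A\<close> to \<open>B\<close> for all disjoint \<open>A\<close>, \<open>B\<close>. Given a colouring, suppose first that
  some vertex \<open>v\<close> has linearly large in- and out-neighbourhoods \<open>B\<close> and \<open>A\<close> in one colour. Averaging
  over \<open>b \<in> B\<close> gives a root \<open>b\<close> that has about \<open>n/2\<close> out-neighbours and, in addition, linearly many
  in-neighbours in \<open>A\<close>, all of which are reached by monochromatic paths of length two through \<open>v\<close>.
  If there is no such \<open>v\<close>, label each vertex with the set of colours in which its out-degree is
  large. Each arc between vertices with the same label lies in a small monochromatic in- or
  out-neighbourhood of one of its ends, so there are few such arcs; but some label is shared by
  \<open>n/2\<^sup>k\<close> vertices, which span a quadratic number of arcs.

  (b) Split the vertices into \<open>m\<close> equal parts labelled by an antichain of \<open>m\<close> subsets of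
  \<open>{1..k - 1}\<close>. Colour arcs from part \<open>X\<close> to part \<open>Y\<close> by an element of \<open>X - Y\<close>, and arcs inside
  parts by \<open>k\<close>. A monochromatic path leaving its part is then a single arc, so a root reaches only
  its own part and its out-neighbours: about \<open>n/2 + n/(2m)\<close> vertices.
\<close>

section \<open>Rooted trees given by a parent function\<close>

lemma tl_pawalk_verts: "pcas u p v \<Longrightarrow> tl (pawalk_verts u p) = map snd p"
proof (induction p arbitrary: u)
  case (Cons e p)
  then show ?case by (cases p) auto
qed simp

lemma pcas_nth_Suc: "pcas u p v \<Longrightarrow> Suc i < length p \<Longrightarrow> fst (p ! Suc i) = snd (p ! i)"
proof (induction p arbitrary: u i)
  case (Cons e p)
  then show ?case by (cases p; cases i) auto
qed simp

lemma pcas_last: "pcas u p v \<Longrightarrow> p \<noteq> [] \<Longrightarrow> snd (last p) = v"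
  by (induction p arbitrary: u) auto

text \<open>Both cyclic neighbours of a vertex of maximal rank would have to be its parent.\<close>

lemma parent_relation_acyclic:
  fixes rk :: "'a \<Rightarrow> nat"
  assumes arc: "\<And>x y. (x, y) \<in> set p \<Longrightarrow> x = par y \<and> rk x < rk y \<or> y = par x \<and> rk y < rk x"
    and cas: "pcas u p u" and dist: "distinct (map snd p)" and len: "3 \<le> length p"
  shows False
proof -
  define l where "l = length p"
  \<comment> \<open>Reducing the index modulo \<open>l\<close> makes the vertices of the closed walk
    cyclic, so that neighbours exist on both sides of every index.\<close>
  define h where "h i = snd (p ! (i mod l))" for i
  have l: "l \<ge> 3" "l > 0" using len by (auto simp: l_def)
  have step: "p ! (Suc i mod l) = (h i, h (Suc i))" for i
  proof -
    have "fst (p ! (Suc i mod l)) = snd (p ! (i mod l))"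
    proof (cases "Suc (i mod l) < l")
      case True
      then show ?thesis using pcas_nth_Suc[OF cas, of "i mod l"] by (simp add: mod_Suc l_def)
    next
      case False
      then have eq: "i mod l = l - 1" using l mod_less_divisor[of l i] by linarith
      then have "Suc i mod l = 0" using l by (simp add: mod_Suc)
      moreover have "snd (p ! (l - 1)) = u"
        using pcas_last[OF cas] l by (auto simp: last_conv_nth l_def)
      moreover have "fst (p ! 0) = u" using cas l by (cases p) (auto simp: l_def)
      ultimately show ?thesis using eq by simp
    qed
    then show ?thesis by (simp add: h_def prod_eq_iff)
  qed
  have in_p: "(h i, h (Suc i)) \<in> set p" for i
    using nth_mem[of "Suc i mod l" p] l unfolding step l_def[symmetric] by simp
  obtain i where i: "i < l" "\<And>j. j < l \<Longrightarrow> rk (h j) \<le> rk (h i)"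
  proof -
    have "Max ((\<lambda>j. rk (h j)) ` {..<l}) \<in> (\<lambda>j. rk (h j)) ` {..<l}"
      using l by (intro Max_in) (auto simp: lessThan_empty_iff)
    then obtain i where "i < l" "rk (h i) = Max ((\<lambda>j. rk (h j)) ` {..<l})" by auto
    then show ?thesis using that by simp
  qed
  have max: "rk (h j) \<le> rk (h i)" for j
    using i(2)[of "j mod l"] l by (simp add: h_def)
  \<comment> \<open>This is the cyclic predecessor of \<open>i\<close>; adding \<open>l\<close>
    keeps the subtraction from truncating at \<open>i = 0\<close>.\<close>
  define j where "j = i + l - 1"
  have hj: "h (Suc j) = h i" using l by (simp add: j_def h_def)
  have "h j = par (h i)" using arc[OF in_p[of j]] max[of j] hj by auto
  moreover have "h (Suc i) = par (h i)" using arc[OF in_p[of i]] max[of "Suc i"] by auto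
  \<comment> \<open>The predecessor and the successor of the highest vertex both equal its parent.
    Distinctness then equates their indices, which for \<open>l \<ge> 3\<close> differ modulo
    \<open>l\<close>.\<close>
  ultimately have "map snd p ! (j mod l) = map snd p ! (Suc i mod l)"
    using l by (simp add: h_def l_def)
  then have "j mod l = Suc i mod l"
    using dist l by (subst (asm) nth_eq_iff_index_eq) (auto simp: l_def)
  moreover have "Suc i mod l = (if Suc i = l then 0 else Suc i)" using i(1) by simp
  moreover have "j mod l = (if i = 0 then l - 1 else i - 1)"
  proof (cases "i = 0")
    case False
    then have "j = (i - 1) + l" by (simp add: j_def)
    then have "j mod l = (i - 1) mod l" by (metis mod_add_self2)
    then show ?thesis using False i(1) by simp
  qed (use l in \<open>simp add: j_def\<close>)
  ultimately show False using l i(1) by (auto split: if_splits)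
qed

text \<open>Encoding a tree by its parent function reduces the tree axioms to the existence of a
  rank that increases by one along each arc.\<close>

definition parent_digraph :: "'a set \<Rightarrow> 'a \<Rightarrow> ('a \<Rightarrow> 'a) \<Rightarrow> 'a pair_pre_digraph" where
  "parent_digraph V r par = \<lparr>pverts = V, parcs = (\<lambda>v. (par v, v)) ` (V - {r})\<rparr>"

lemma parent_digraph_simps [simp]:
  "pverts (parent_digraph V r par) = V"
  "parcs (parent_digraph V r par) = (\<lambda>v. (par v, v)) ` (V - {r})"
  by (simp_all add: parent_digraph_def)

text \<open>Up to a constant, \<open>rk\<close> is the distance from the root. Its growth along arcs
  excludes loops and opposite arcs, and, by \<open>parent_relation_acyclic\<close>, undirected
  cycles; induction on it reaches every vertex from \<open>r\<close>.\<close>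

lemma
  fixes rk :: "'a \<Rightarrow> nat"
  assumes fin: "finite V" and r: "r \<in> V"
    and par: "\<And>v. v \<in> V \<Longrightarrow> v \<noteq> r \<Longrightarrow> par v \<in> V \<and> rk v = Suc (rk (par v))"
  shows pair_digraph_parent_digraph: "pair_digraph (parent_digraph V r par)"
    and arborescence_parent_digraph: "arborescence (parent_digraph V r par) r"
proof -
  let ?H = "parent_digraph V r par"
  show "pair_digraph ?H"
    using fin par by unfold_locales force+
  then interpret H: pair_digraph ?H .
  interpret S: pair_wf_digraph "mk_symmetric (with_proj ?H)"
    by (rule H.wellformed_mk_symmetric)
  have reach: "r \<rightarrow>\<^sup>*\<^bsub>with_proj ?H\<^esub> v" if "v \<in> V" for v
    using that
  proof (induction "rk v" arbitrary: v rule: less_induct)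
    case less
    show ?case
    proof (cases "v = r")
      case True
      then show ?thesis using r by (simp add: H.reachable_refl)
    next
      case False
      then have "r \<rightarrow>\<^sup>*\<^bsub>with_proj ?H\<^esub> par v" using less par by auto
      moreover have "(par v, v) \<in> parcs ?H" using False less.prems by auto
      ultimately show ?thesis by (rule H.reachable_adj_trans)
    qed
  qed
  have rk_less: "rk x < rk y" if "(x, y) \<in> parcs ?H" for x y
    using that par[of y] by (cases "y = r") auto
  have "asym (parcs ?H)"
    by (rule asymI) (use rk_less in \<open>blast dest: less_asym\<close>)
  \<comment> \<open>In the symmetric closure the walks from the root can be reversed, so any two
    vertices are joined through \<open>r\<close>.\<close>
  moreover have "connected (with_proj ?H)"
  proof -
    have "u \<rightarrow>\<^sup>*\<^bsub>with_proj (mk_symmetric (with_proj ?H))\<^esub> v" if "u \<in> V" "v \<in> V" for u v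
    proof -
      have "r \<rightarrow>\<^sup>*\<^bsub>with_proj (mk_symmetric (with_proj ?H))\<^esub> w" if "w \<in> V" for w
        using reach[OF that] by (rule H.reachable_mk_symmetricI)
      then show ?thesis
        using S.reachable_trans[OF symmetric_reachable[OF symmetric_mk_symmetric]] that by metis
    qed
    then show ?thesis using r by (auto simp: connected_def)
  qed
  moreover have "\<nexists>p. pre_digraph.cycle (with_proj (mk_symmetric (with_proj ?H))) p \<and> 3 \<le> length p"
  proof (intro notI, elim exE conjE)
    fix p assume "S.cycle p" and len: "3 \<le> length p"
    then obtain u where u: "S.awalk u p u" "distinct (tl (pawalk_verts u p))"
      by (auto simp: S.cycle_def)
    then have cas: "pcas u p u" and arcs: "set p \<subseteq> parcs (mk_symmetric (with_proj ?H))"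
      by (auto simp: S.awalk_def)
    show False
    proof (rule parent_relation_acyclic[of p par rk u])
      fix x y assume "(x, y) \<in> set p"
      then have "(x, y) \<in> parcs ?H \<or> (y, x) \<in> parcs ?H"
        using arcs by (auto simp: parcs_mk_symmetric)
      then show "x = par y \<and> rk x < rk y \<or> y = par x \<and> rk y < rk x"
        using par by force
    qed (use u cas len in \<open>simp_all add: tl_pawalk_verts\<close>)
  qed
  ultimately have "oriented_tree ?H"
    using \<open>pair_digraph ?H\<close> by (simp add: oriented_tree_def)
  then show "arborescence ?H r"
    using reach r by (auto simp: arborescence_def H.reachable_apath)
qed

text \<open>A walk raises the rank by exactly its length, so no path is longer than the largest
  rank.\<close>

lemma depth_parent_digraph_le:
  fixes rk :: "'a \<Rightarrow> nat"
  assumes fin: "finite V" and r: "r \<in> V"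
    and par: "\<And>v. v \<in> V \<Longrightarrow> v \<noteq> r \<Longrightarrow> par v \<in> V \<and> rk v = Suc (rk (par v))"
    and le: "\<And>v. v \<in> V \<Longrightarrow> rk v \<le> d"
  shows "depth (parent_digraph V r par) \<le> d"
proof -
  let ?H = "parent_digraph V r par"
  interpret H: pair_digraph ?H using fin r par by (rule pair_digraph_parent_digraph)
  have rk: "rk v = rk u + length p" if "pcas u p v" "set p \<subseteq> parcs ?H" for u p v
    using that
  proof (induction p arbitrary: u)
    case (Cons e p)
    then have "rk v = rk (snd e) + length p" by simp
    moreover obtain w where "w \<in> V - {r}" "e = (par w, w)" using Cons.prems by auto
    then have "rk (snd e) = Suc (rk u)" using Cons.prems par[of w] by auto
    ultimately show ?case by simp
  qed simp
  let ?L = "{length p | u p v. H.apath u p v}"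
  have "?L = (\<lambda>(u, p, v). length p) ` {(u, p, v). H.apath u p v}" by force
  then have "finite ?L" using H.apaths_finite_triple by simp
  \<comment> \<open>The empty path at the root makes the set nonempty, so that \<open>Max\<close> is
    meaningful.\<close>
  moreover have "length [] \<in> ?L" using r by (force simp: H.apath_Nil_iff)
  moreover have "x \<le> d" if "x \<in> ?L" for x
  proof -
    from that obtain u p v where "x = length p" "H.awalk u p v" by (auto simp: H.apath_def)
    moreover from this have "v \<in> V" using H.awalk_last_in_verts by force
    ultimately show ?thesis
      using rk[of u p v] le[of v] by (auto simp: H.awalk_def)
  qed
  ultimately show ?thesis unfolding depth_def by (subst Max_le_iff) auto
qed

text \<open>Consecutive arcs of a directed path are those entering \<open>par v\<close> and
  \<open>v\<close>, so comparing such pairs settles all paths.\<close>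

lemma path_monochromatic_parent_digraph:
  assumes "\<And>v. v \<in> V \<Longrightarrow> v \<noteq> r \<Longrightarrow> par v \<noteq> r \<Longrightarrow> c (par v, v) = c (par (par v), par v)"
  shows "path_monochromatic c (parent_digraph V r par)"
proof -
  let ?H = "parent_digraph V r par"
  have mono: "\<forall>e\<in>set p. c e = c (hd p)" if "pcas u p v" "set p \<subseteq> parcs ?H" for u p v
    using that
  proof (induction p arbitrary: u)
    case (Cons e p)
    show ?case
    proof (cases p)
      case (Cons e' q)
      obtain v where v: "v \<in> V - {r}" "e = (par v, v)" using Cons.prems by auto
      obtain w where w: "w \<in> V - {r}" "e' = (par w, w)" using Cons.prems Cons by auto
      have "par w = v" using Cons.prems Cons v w by simp
      then have "c e' = c e" using assms[of w] v w by auto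
      then show ?thesis using Cons.IH[of "snd e"] Cons.prems Cons by auto
    qed simp
  qed simp
  have "\<forall>e\<in>set p. \<forall>e'\<in>set p. c e = c e'" if "pre_digraph.apath (with_proj ?H) u p v" for u p v
    using mono[of u p v] that
    by (simp add: pre_digraph.apath_def pre_digraph.awalk_def cas_with_proj_eq)
  then show ?thesis unfolding path_monochromatic_def by blast
qed

section \<open>Depth two in quasirandom tournaments\<close>

lemma card_Int_Times:
  assumes "finite A" "finite B"
  shows "card (R \<inter> A \<times> B) = (\<Sum>a\<in>A. card {b \<in> B. (a, b) \<in> R})"
proof -
  have "R \<inter> A \<times> B = Sigma A (\<lambda>a. {b \<in> B. (a, b) \<in> R})" by auto
  then show ?thesis using assms by simp
qed

lemma card_Int_Times':
  assumes "finite A" "finite B"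
  shows "card (R \<inter> A \<times> B) = (\<Sum>b\<in>B. card {a \<in> A. (a, b) \<in> R})"
proof -
  have "(R \<inter> A \<times> B)\<inverse> = R\<inverse> \<inter> B \<times> A" by auto
  then show ?thesis using card_Int_Times[OF assms(2,1), of "R\<inverse>"] card_inverse[of "R \<inter> A \<times> B"] by simp
qed

lemma tournament_pair_digraph: "tournament T \<Longrightarrow> pair_digraph T"
  unfolding tournament_def by (rule conjunct1)

lemma tournament_arc_iff:
  "tournament T \<Longrightarrow> u \<in> pverts T \<Longrightarrow> v \<in> pverts T \<Longrightarrow> u \<noteq> v \<Longrightarrow> (u, v) \<in> parcs T \<longleftrightarrow> (v, u) \<notin> parcs T"
  unfolding tournament_def by blast

lemma tournament_asym:
  assumes T: "tournament T" and uv: "(u, v) \<in> parcs T"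
  shows "(v, u) \<notin> parcs T"
proof -
  interpret pair_digraph T using T by (rule tournament_pair_digraph)
  show ?thesis
    using tournament_arc_iff[OF T in_arcsD1[OF uv] in_arcsD2[OF uv] no_loops'[OF uv]] uv by blast
qed

text \<open>The square \<open>W \<times> W\<close> splits into the arcs, their reversals and the
  diagonal. The additive form avoids subtraction of natural numbers.\<close>

lemma card_arcs_inside:
  assumes T: "tournament T" and W: "W \<subseteq> pverts T"
  shows "2 * card (parcs T \<inter> W \<times> W) + card W = card W * card W"
proof -
  interpret pair_digraph T using T by (rule tournament_pair_digraph)
  let ?E = "parcs T \<inter> W \<times> W"
  have finW: "finite W" using W finite_subset pair_finite_verts by blast
  have "W \<times> W = (?E \<union> ?E\<inverse>) \<union> (\<lambda>v. (v, v)) ` W"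
  proof -
    have "(u, v) \<in> ?E \<union> ?E\<inverse> \<or> u = v" if "u \<in> W" "v \<in> W" for u v
      using that W tournament_arc_iff[OF T, of u v] by auto
    then show ?thesis by auto
  qed
  also have "card \<dots> = card (?E \<union> ?E\<inverse>) + card ((\<lambda>v. (v, v)) ` W)"
    by (intro card_Un_disjoint) (use finW no_loops' in auto)
  also have "card (?E \<union> ?E\<inverse>) = card ?E + card (?E\<inverse>)"
    by (intro card_Un_disjoint) (use finW tournament_asym[OF T] in auto)
  also have "card ((\<lambda>v. (v, v)) ` W) = card W"
    by (simp add: card_image inj_on_def)
  finally show ?thesis by (simp add: card_inverse card_cartesian_product)
qed

lemma subgraph_parent_digraph:
  assumes T: "pair_digraph T" and H: "pair_digraph (parent_digraph V r par)"
    and "V \<subseteq> pverts T" and "\<And>v. v \<in> V \<Longrightarrow> v \<noteq> r \<Longrightarrow> (par v, v) \<in> parcs T"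
  shows "subgraph (with_proj (parent_digraph V r par)) (with_proj T)"
proof -
  interpret T: pair_digraph T by fact
  interpret H: pair_digraph "parent_digraph V r par" by fact
  show ?thesis
    using assms(3,4) T.wf_digraph_axioms H.wf_digraph_axioms
    by (auto simp: subgraph_def compatible_def)
qed

text \<open>All out-neighbours of \<open>b\<close> become its children, \<open>v\<close> among them,
  and \<open>D\<close> hangs below \<open>v\<close>. The only paths of length two pass through
  \<open>v\<close> and have the colour of \<open>(b, v)\<close>. As \<open>D\<close> consists of
  in-neighbours of \<open>b\<close>, it is disjoint from the children and the sizes add up.\<close>

lemma two_level_arborescence:
  assumes T: "tournament T" and bv: "(b, v) \<in> parcs T"
    and D: "D \<subseteq> {a. (v, a) \<in> parcs T \<and> c (v, a) = c (b, v) \<and> (a, b) \<in> parcs T}"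
  obtains H where "subgraph (with_proj H) (with_proj T)" "arborescence H b"
    "path_monochromatic c H" "depth H \<le> 2"
    "card (pverts H) = 1 + card {u \<in> pverts T. (b, u) \<in> parcs T} + card D"
proof -
  interpret T: pair_digraph T using T by (rule tournament_pair_digraph)
  define N where "N = {u \<in> pverts T. (b, u) \<in> parcs T}"
  define V where "V = insert b (N \<union> D)"
  define par where "par w = (if (b, w) \<in> parcs T then b else v)" for w
  define rk where "rk w = (if w = b then 0 else if (b, w) \<in> parcs T then 1 else 2 :: nat)" for w
  have sub: "V \<subseteq> pverts T" using D bv T.in_arcsD1 T.in_arcsD2 by (auto simp: V_def N_def)
  then have finV: "finite V" using T.pair_finite_verts finite_subset by blast
  have bV: "b \<in> V" by (simp add: V_def)
  have loop: "(x, x) \<notin> parcs T" for x using T.no_loops' by blast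
  have DN: "(b, a) \<notin> parcs T" if "a \<in> D" for a
    using that D tournament_asym[OF T] by blast
  have vb: "v \<noteq> b" "v \<in> N" using bv loop T.in_arcsD2 by (auto simp: N_def)
  have par: "par w \<in> V \<and> rk w = Suc (rk (par w))" if "w \<in> V" "w \<noteq> b" for w
    using that vb loop DN bv by (auto simp: par_def rk_def V_def N_def)
  have arc: "(par w, w) \<in> parcs T" if "w \<in> V" "w \<noteq> b" for w
    using that D by (auto simp: par_def V_def N_def)
  let ?H = "parent_digraph V b par"
  note H = pair_digraph_parent_digraph[of V b par rk, OF finV bV par]
  have "subgraph (with_proj ?H) (with_proj T)"
    by (rule subgraph_parent_digraph[OF T.pair_digraph H sub arc])
  moreover have "arborescence ?H b"
    by (rule arborescence_parent_digraph[of V b par rk, OF finV bV par])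
  moreover have "depth ?H \<le> 2"
    by (rule depth_parent_digraph_le[of V b par rk, OF finV bV par]) (auto simp: rk_def)
  moreover have "path_monochromatic c ?H"
    by (rule path_monochromatic_parent_digraph) (use D bv in \<open>auto simp: par_def V_def N_def\<close>)
  moreover have "card (pverts ?H) = 1 + card N + card D"
  proof -
    have "b \<notin> N \<union> D" using loop D by (auto simp: N_def)
    moreover have "N \<inter> D = {}" using DN by (auto simp: N_def)
    ultimately show ?thesis using finV by (simp add: V_def card_Un_disjoint)
  qed
  ultimately show ?thesis using that unfolding N_def by blast
qed

text \<open>A one-sided bound suffices: in a tournament, exchanging \<open>A\<close> and
  \<open>B\<close> turns it into an upper bound.\<close>

definition quasirandom :: "real \<Rightarrow> 'a pair_pre_digraph \<Rightarrow> bool" where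
  "quasirandom \<eta> T \<longleftrightarrow> (\<forall>A B. A \<subseteq> pverts T \<longrightarrow> B \<subseteq> pverts T \<longrightarrow> A \<inter> B = {} \<longrightarrow>
     real (card A) * real (card B) / 2 - \<eta> * (real (card (pverts T)))\<^sup>2 \<le> real (card (parcs T \<inter> A \<times> B)))"

text \<open>Averaging over \<open>B\<close>: the out-degrees sum to about
  \<open>card B * n / 2\<close> and the in-degrees from \<open>A\<close> to about
  \<open>card A * card B / 2\<close>. Half of the gain \<open>\<delta> * n / 2\<close> per vertex
  pays for the two error terms; this fixes \<eta>.\<close>

lemma ex_vertex_large_in_out:
  assumes T: "tournament T" and "quasirandom \<eta> T" and \<delta>: "\<delta> > 0" and n: "n = card (pverts T)" "n > 0"
    and A: "A \<subseteq> pverts T" "real (card A) \<ge> \<delta> * n"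
    and B: "B \<subseteq> pverts T" "real (card B) \<ge> \<delta> * n"
    and disj: "A \<inter> B = {}" and \<eta>: "\<eta> = \<delta>\<^sup>2 / 8"
  shows "\<exists>b\<in>B. (1/2 + \<delta>/4) * n \<le>
    real (1 + card {u \<in> pverts T. (b, u) \<in> parcs T} + card {a \<in> A. (a, b) \<in> parcs T})"
proof (rule ccontr)
  assume not: "\<not> ?thesis"
  interpret T: pair_digraph T using T by (rule tournament_pair_digraph)
  note fin = finite_subset[OF _ T.pair_finite_verts]
  have finA: "finite A" and finB: "finite B" using A B fin by auto
  let ?out = "\<lambda>b. card {u \<in> pverts T. (b, u) \<in> parcs T}"
  let ?in = "\<lambda>b. card {a \<in> A. (a, b) \<in> parcs T}"
  define e where "e X Y = card (parcs T \<inter> X \<times> Y)" for X Y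
  define x where "x = real (card B)"
  define y where "y = real (card A)"
  have qr: "real (card X) * real (card Y) / 2 - \<eta> * (real n)\<^sup>2 \<le> real (e X Y)"
    if "X \<subseteq> pverts T" "Y \<subseteq> pverts T" "X \<inter> Y = {}" for X Y
    using assms(2) that unfolding quasirandom_def n e_def by blast
  have "(\<Sum>b\<in>B. ?out b) = e B (pverts T)"
    unfolding e_def using card_Int_Times[OF finB T.pair_finite_verts, of "parcs T"] by simp
  \<comment> \<open>Quasirandomness speaks of disjoint sets only; the arcs inside \<open>B\<close>
    are counted exactly.\<close>
  also have "e B (pverts T) = e B B + e B (pverts T - B)"
  proof -
    have "parcs T \<inter> B \<times> pverts T = (parcs T \<inter> B \<times> B) \<union> (parcs T \<inter> B \<times> (pverts T - B))"
      using B by auto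
    then show ?thesis unfolding e_def by (simp only:) (intro card_Un_disjoint, use T.pair_finite_arcs in auto)
  qed
  finally have out: "(\<Sum>b\<in>B. ?out b) = e B B + e B (pverts T - B)" .
  have inn: "(\<Sum>b\<in>B. ?in b) = e A B"
    unfolding e_def using card_Int_Times'[OF finA finB, of "parcs T"] by simp
  have "real (2 * e B B + card B) = real (card B * card B)"
    using card_arcs_inside[OF T B(1)] by (simp add: e_def)
  then have eBB: "real (e B B) = (x * x - x) / 2" by (simp add: x_def)
  have cB: "real (card (pverts T - B)) = n - x"
    using B(1) finB card_mono[OF T.pair_finite_verts B(1)] by (simp add: card_Diff_subset x_def n of_nat_diff)
  have "x * (n - x) / 2 - \<eta> * (real n)\<^sup>2 \<le> real (e B (pverts T - B))"
    using qr[of B "pverts T - B"] B(1) cB by (auto simp: x_def)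
  moreover have "y * x / 2 - \<eta> * (real n)\<^sup>2 \<le> real (e A B)"
    using qr[of A B] A B disj by (auto simp: x_def y_def)
  moreover have "real (\<Sum>b\<in>B. 1 + ?out b + ?in b) = x + real (e B B) + real (e B (pverts T - B)) + real (e A B)"
    using out inn by (simp add: sum.distrib x_def del: One_nat_def of_nat_sum)
  ultimately have "real (\<Sum>b\<in>B. 1 + ?out b + ?in b) \<ge> x * n / 2 + y * x / 2 + x / 2 - 2 * \<eta> * (real n)\<^sup>2"
    unfolding eBB by (simp add: algebra_simps diff_divide_distrib add_divide_distrib)
  moreover have "real (\<Sum>b\<in>B. 1 + ?out b + ?in b) \<le> (\<Sum>b\<in>B. (1/2 + \<delta>/4) * n)"
    unfolding of_nat_sum by (intro sum_mono) (use not in force)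
  ultimately have "x * n / 2 + y * x / 2 + x / 2 - 2 * \<eta> * (real n)\<^sup>2 \<le> x * n / 2 + \<delta> * n * x / 4"
    by (simp add: x_def algebra_simps)
  moreover have "2 * \<eta> * (real n)\<^sup>2 \<le> \<delta> * n * x / 4"
    using mult_right_mono[OF B(2), of "\<delta> * n / 4"] \<delta> by (simp add: \<eta> x_def power2_eq_square algebra_simps)
  moreover have "\<delta> * n * x \<le> y * x"
    using A(2) by (intro mult_right_mono) (auto simp: x_def y_def)
  \<comment> \<open>The surplus \<open>x / 2\<close>, left from the summand 1 after the diagonal
    correction in \<open>eBB\<close>, makes the contradiction strict.\<close>
  moreover have "x > 0" using B(2) \<delta> n(2) unfolding x_def by (intro less_le_trans[OF _ B(2)]) simp
  ultimately show False by linarith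
qed

text \<open>Otherwise every vertex is small on one side in each colour. Vertices that agree on the
  side span at most \<open>k * \<delta> * n\<close> arcs per vertex, too few for a class of at least
  \<open>n / 2 ^ k\<close> vertices.\<close>

lemma mono_in_out_neighbourhoods:
  assumes T: "tournament T" and c: "edge_coloring k T c" and k: "k \<ge> 1" and n: "n = card (pverts T)" "n > 2 ^ (k + 1)"
    and \<delta>: "\<delta> = 1 / (4 * real k * 2 ^ k)"
  shows "\<exists>v\<in>pverts T. \<exists>i. \<delta> * n \<le> card {u \<in> pverts T. (u, v) \<in> parcs T \<and> c (u, v) = i} \<and>
    \<delta> * n \<le> card {u \<in> pverts T. (v, u) \<in> parcs T \<and> c (v, u) = i}"
proof (rule ccontr)
  assume not: "\<not> ?thesis"
  interpret T: pair_digraph T using T by (rule tournament_pair_digraph)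
  define In where "In i v = {u \<in> pverts T. (u, v) \<in> parcs T \<and> c (u, v) = i}" for i v
  define Out where "Out i v = {u \<in> pverts T. (v, u) \<in> parcs T \<and> c (v, u) = i}" for i v
  have fin: "finite (In i v)" "finite (Out i v)" for i v
    using T.pair_finite_verts by (auto simp: In_def Out_def)
  have small: "card (In i v) < \<delta> * n \<or> card (Out i v) < \<delta> * n" if "v \<in> pverts T" for i v
  proof (rule ccontr)
    assume "\<not> ?thesis"
    then have "\<delta> * n \<le> card (In i v) \<and> \<delta> * n \<le> card (Out i v)" by linarith
    with not that show False unfolding In_def Out_def by blast
  qed
  define t where "t v = {i \<in> {1..k}. card (Out i v) \<ge> \<delta> * n}" for v
  define W where "W s = {v \<in> pverts T. t v = s}" for s
  \<comment> \<open>Pigeonhole over the \<open>2 ^ k\<close> possible values of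
    \<open>t\<close>.\<close>
  have "\<exists>s. n \<le> 2 ^ k * card (W s)"
  proof (rule ccontr)
    assume "\<nexists>s. n \<le> 2 ^ k * card (W s)"
    then have lt: "2 ^ k * card (W s) < n" for s by (meson not_less)
    have "t v \<in> Pow {1..k}" for v by (auto simp: t_def)
    then have "pverts T = (\<Union>s\<in>Pow {1..k}. W s)" unfolding W_def by blast
    then have "n = card (\<Union>s\<in>Pow {1..k}. W s)" using n(1) by metis
    also have "\<dots> \<le> (\<Sum>s\<in>Pow {1..k}. card (W s))" by (rule card_UN_le) simp
    finally have "n \<le> (\<Sum>s\<in>Pow {1..k}. card (W s))" .
    then have "2 ^ k * n \<le> (\<Sum>s\<in>Pow {1..k}. 2 ^ k * card (W s))" by (simp flip: sum_distrib_left)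
    also have "\<dots> < (\<Sum>s\<in>Pow {1..k}. n)" by (intro sum_strict_mono lt) auto
    finally show False by (simp add: card_Pow)
  qed
  then obtain s where s: "n \<le> 2 ^ k * card (W s)" ..
  have Wsub: "W s \<subseteq> pverts T" by (auto simp: W_def)
  then have finW: "finite (W s)" using T.pair_finite_verts finite_subset by blast
  \<comment> \<open>For \<open>i \<in> s\<close> all vertices of \<open>W s\<close> have large
    out-neighbourhoods in colour \<open>i\<close>, hence small in-neighbourhoods, and arcs are
    charged to their heads; otherwise they are charged to their tails. The converse turns pairs of
    head and tail into arcs.\<close>
  define F where "F i = (if i \<in> s then (Sigma (W s) (In i))\<inverse> else Sigma (W s) (Out i))" for i
  have finF: "finite (F i)" for i using finW fin by (simp add: F_def)
  have "parcs T \<inter> W s \<times> W s \<subseteq> (\<Union>i\<in>{1..k}. F i)"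
  proof
    fix e assume e: "e \<in> parcs T \<inter> W s \<times> W s"
    then have "c e \<in> {1..k}" using c by (auto simp: edge_coloring_def)
    moreover have "e \<in> F (c e)" using e Wsub by (auto simp: F_def In_def Out_def)
    ultimately show "e \<in> (\<Union>i\<in>{1..k}. F i)" by blast
  qed
  then have "card (parcs T \<inter> W s \<times> W s) \<le> card (\<Union>i\<in>{1..k}. F i)"
    using finF by (intro card_mono) auto
  also have "\<dots> \<le> (\<Sum>i\<in>{1..k}. card (F i))" by (intro card_UN_le) auto
  finally have "real (card (parcs T \<inter> W s \<times> W s)) \<le> (\<Sum>i\<in>{1..k}. real (card (F i)))"
    by (simp flip: of_nat_sum)
  also have "\<dots> \<le> (\<Sum>i\<in>{1..k}. real (card (W s)) * (\<delta> * n))"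
  proof (rule sum_mono)
    fix i assume i: "i \<in> {1..k}"
    have "card (F i) = (\<Sum>v\<in>W s. if i \<in> s then card (In i v) else card (Out i v))"
      using finW fin by (simp add: F_def card_inverse)
    also have "real \<dots> \<le> (\<Sum>v\<in>W s. \<delta> * n)"
      unfolding of_nat_sum
    proof (rule sum_mono)
      fix v assume "v \<in> W s"
      then have "t v = s" "v \<in> pverts T" by (auto simp: W_def)
      then show "real (if i \<in> s then card (In i v) else card (Out i v)) \<le> \<delta> * n"
        using small[of v i] i by (auto simp: t_def)
    qed
    finally show "real (card (F i)) \<le> real (card (W s)) * (\<delta> * n)" by simp
  qed
  also have "\<dots> = real (card (W s)) * (k * \<delta> * n)" by simp
  finally have le: "real (card (parcs T \<inter> W s \<times> W s)) \<le> real (card (W s)) * (k * \<delta> * n)" .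
  define w where "w = real (card (W s))"
  have "real (2 * card (parcs T \<inter> W s \<times> W s) + card (W s)) = real (card (W s) * card (W s))"
    using card_arcs_inside[OF T Wsub] by simp
  then have "w * w \<le> w * (2 * (k * \<delta> * n) + 1)"
    using le by (simp add: w_def algebra_simps)
  moreover have "w > 0" using s n by (auto simp: w_def intro!: Nat.gr0I)
  ultimately have "w \<le> 2 * (k * \<delta> * n) + 1" by (simp add: mult_le_cancel_left)
  \<comment> \<open>The value of \<delta> makes this half of the lower bound
    \<open>n / 2 ^ k\<close> on \<open>w\<close>; \<open>n > 2 ^ (k + 1)\<close> then absorbs the
    diagonal term 1.\<close>
  also have "2 * (k * \<delta> * n) = n / (2 * 2 ^ k)" using k by (simp add: \<delta>)
  finally have "2 ^ k * w \<le> n / 2 + 2 ^ k" by (simp add: field_simps)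
  moreover have "real n \<le> 2 ^ k * w" using s unfolding w_def by (metis of_nat_le_iff of_nat_mult of_nat_numeral of_nat_power)
  moreover have "real n > 2 ^ (k + 1)" using n(2) by (metis of_nat_less_iff of_nat_numeral of_nat_power)
  ultimately show False by simp
qed

lemma f_depth_2_ge:
  assumes T: "tournament T" and k: "k \<ge> 1" and n: "n = card (pverts T)" "n > 2 ^ (k + 1)"
    and \<delta>: "\<delta> = 1 / (4 * real k * 2 ^ k)" and qr: "quasirandom (\<delta>\<^sup>2 / 8) T"
  shows "(\<delta> / 4 + 1 / 2) * n \<le> real (f_depth T k 2)"
proof -
  interpret T: pair_digraph T using T by (rule tournament_pair_digraph)
  let ?P = "\<lambda>m. \<forall>c. edge_coloring k T c \<longrightarrow>
     (\<exists>H r. subgraph (with_proj H) (with_proj T) \<and> arborescence H r \<and> path_monochromatic c H \<and>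
        depth H \<le> 2 \<and> m \<le> card (pverts H))"
  have \<delta>0: "\<delta> > 0" using k by (simp add: \<delta>)
  \<comment> \<open>The ceiling is the least natural number that reaches the real bound.\<close>
  have "?P (nat \<lceil>(\<delta> / 4 + 1 / 2) * n\<rceil>)"
  proof (intro allI impI)
    fix c assume c: "edge_coloring k T c"
    obtain v i where v: "v \<in> pverts T"
      "\<delta> * n \<le> card {u \<in> pverts T. (u, v) \<in> parcs T \<and> c (u, v) = i}" (is "_ \<le> real (card ?B)")
      "\<delta> * n \<le> card {u \<in> pverts T. (v, u) \<in> parcs T \<and> c (v, u) = i}" (is "_ \<le> real (card ?A)")
      using mono_in_out_neighbourhoods[OF T c k n \<delta>] by blast
    have "?A \<inter> ?B = {}" using tournament_asym[OF T] by auto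
    then obtain b where b: "b \<in> ?B" "(1/2 + \<delta>/4) * n \<le>
        real (1 + card {u \<in> pverts T. (b, u) \<in> parcs T} + card {a \<in> ?A. (a, b) \<in> parcs T})"
      using ex_vertex_large_in_out[OF T qr \<delta>0 n(1) _ _ v(3) _ v(2) _ refl] n by auto
    obtain H where "subgraph (with_proj H) (with_proj T)" "arborescence H b"
      "path_monochromatic c H" "depth H \<le> 2"
      and H: "card (pverts H) = 1 + card {u \<in> pverts T. (b, u) \<in> parcs T} + card {a \<in> ?A. (a, b) \<in> parcs T}"
      by (rule two_level_arborescence[OF T, of b v "{a \<in> ?A. (a, b) \<in> parcs T}" c]) (use b in auto)
    moreover have "nat \<lceil>(\<delta> / 4 + 1 / 2) * n\<rceil> \<le> card (pverts H)"
      using b(2) unfolding H[symmetric] by (simp add: nat_le_iff ceiling_le_iff add.commute)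
    ultimately show "\<exists>H r. subgraph (with_proj H) (with_proj T) \<and> arborescence H r \<and> path_monochromatic c H \<and>
        depth H \<le> 2 \<and> nat \<lceil>(\<delta> / 4 + 1 / 2) * n\<rceil> \<le> card (pverts H)" by blast
  qed
  \<comment> \<open>\<open>GREATEST\<close> is meaningful for a bounded predicate; a single
    admissible colouring already bounds \<open>m\<close> by the number of vertices.\<close>
  moreover have "m \<le> n" if P: "?P m" for m
  proof -
    have "edge_coloring k T (\<lambda>_. 1)" using k by (simp add: edge_coloring_def)
    from P[rule_format, OF this]
    obtain H where H: "subgraph (with_proj H) (with_proj T)" "m \<le> card (pverts H)" by blast
    then have "pverts H \<subseteq> pverts T" by (simp add: subgraph_def)
    from card_mono[OF T.pair_finite_verts this] show ?thesis using H(2) n(1) by linarith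
  qed
  ultimately have "nat \<lceil>(\<delta> / 4 + 1 / 2) * n\<rceil> \<le> f_depth T k 2"
    unfolding f_depth_def by (rule Greatest_le_nat)
  then show ?thesis by (simp add: nat_le_iff ceiling_le_iff)
qed

section \<open>Concentration of arc counts\<close>

text \<open>\<open>J\<close> indexes the coins between \<open>A\<close> and \<open>B\<close>. A coin
  contributes an arc from \<open>A\<close> to \<open>B\<close> if it shows heads and its smaller
  vertex lies in \<open>A\<close>, or tails and that vertex lies in \<open>B\<close>. The count thus
  becomes a sum over independent coins.\<close>

lemma card_arcs_tournament_of_coins:
  assumes A: "A \<subseteq> {1..n}" and B: "B \<subseteq> {1..n}" and disj: "A \<inter> B = {}"
  defines "J \<equiv> {(i, j). i < j \<and> (i \<in> A \<and> j \<in> B \<or> i \<in> B \<and> j \<in> A)}"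
  shows "real (card (parcs (tournament_of_coins n x) \<inter> A \<times> B)) =
      (\<Sum>p\<in>J. of_bool (x p = (fst p \<in> A)))" (is ?card)
    and "card J = card A * card B"
proof -
  have fin: "finite A" "finite B" using A B finite_subset by blast+
  define \<psi> where "\<psi> = (\<lambda>(a, b). if a < b then (a, b) else (b, a :: nat))"
  have bij: "bij_betw \<psi> (A \<times> B) J"
  proof (rule bij_betwI[where g = "\<lambda>(i, j). if i \<in> A then (i, j) else (j, i)"])
    show "\<psi> \<in> A \<times> B \<rightarrow> J" using disj by (auto simp: \<psi>_def J_def not_less_iff_gr_or_eq split: if_splits)
  qed (use disj in \<open>auto simp: \<psi>_def J_def split: if_splits\<close>)
  then show "card J = card A * card B"
    using bij_betw_same_card[OF bij] by (simp add: card_cartesian_product)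
  have arc: "q \<in> parcs (tournament_of_coins n x) \<longleftrightarrow> x (\<psi> q) = (fst (\<psi> q) \<in> A)" if q_in: "q \<in> A \<times> B" for q
  proof -
    obtain a b where q: "q = (a, b)" "a \<in> A" "b \<in> B" using q_in by auto
    then have "a \<in> {1..n}" "b \<in> {1..n}" "a \<noteq> b" "b \<notin> A" using A B disj by auto
    then show ?thesis using q by (auto simp: \<psi>_def tournament_of_coins_def)
  qed
  have "real (card (parcs (tournament_of_coins n x) \<inter> A \<times> B)) =
      (\<Sum>q\<in>A \<times> B. of_bool (q \<in> parcs (tournament_of_coins n x)))"
    using fin by (simp add: of_bool_def sum.If_cases Int_commute)
  also have "\<dots> = (\<Sum>q\<in>A \<times> B. of_bool (x (\<psi> q) = (fst (\<psi> q) \<in> A)))"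
    by (intro sum.cong refl) (simp add: arc)
  also have "\<dots> = (\<Sum>p\<in>J. of_bool (x p = (fst p \<in> A)))"
    using sum.reindex_bij_betw[OF bij, of "\<lambda>p. of_bool (x p = (fst p \<in> A))"] by simp
  finally show ?card .
qed

lemma expectation_coin_eq:
  assumes "finite I" "p \<in> I"
  shows "measure_pmf.expectation (Pi_pmf I d (\<lambda>_. bernoulli_pmf (1/2))) (\<lambda>x. of_bool (x p = s) :: real) = 1/2"
proof -
  have "measure_pmf.expectation (Pi_pmf I d (\<lambda>_. bernoulli_pmf (1/2))) (\<lambda>x. of_bool (x p = s) :: real) =
      measure_pmf.expectation (map_pmf (\<lambda>x. x p) (Pi_pmf I d (\<lambda>_. bernoulli_pmf (1/2)))) (\<lambda>y. of_bool (y = s))"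
    by simp
  also have "map_pmf (\<lambda>x. x p) (Pi_pmf I d (\<lambda>_. bernoulli_pmf (1/2))) = bernoulli_pmf (1/2)"
    using assms by (simp add: Pi_pmf_component)
  also have "measure_pmf.expectation (bernoulli_pmf (1/2)) (\<lambda>y. of_bool (y = s) :: real) = 1/2"
    by (cases s) simp_all
  finally show ?thesis .
qed

text \<open>Hoeffding's inequality for the coins between \<open>A\<close> and \<open>B\<close>, each
  of mean \<open>1/2\<close>. Replacing their number by an upper bound \<open>N\<close> makes the
  estimate uniform over the sets in a union bound.\<close>

lemma prob_few_arcs_le:
  assumes A: "A \<subseteq> {1..n}" and B: "B \<subseteq> {1..n}" and disj: "A \<inter> B = {}" and t: "t \<ge> 0"
    and N: "real (card A * card B) \<le> N"
  shows "measure_pmf.prob (random_tournament n)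
      {T. real (card (parcs T \<inter> A \<times> B)) < real (card A) * real (card B) / 2 - t} \<le> exp (- 2 * t\<^sup>2 / N)"
\<comment> \<open>Hoeffding's bound divides by the number of coins. Without coins the event itself
  is empty because \<open>t \<ge> 0\<close>.\<close>
proof (cases "A = {} \<or> B = {}")
  case True
  then have "{T :: nat pair_pre_digraph. real (card (parcs T \<inter> A \<times> B)) < real (card A) * real (card B) / 2 - t} = {}"
    using t by auto
  then show ?thesis by (simp only: measure_empty exp_ge_zero)
next
  case False
  have fin: "finite A" "finite B" using A B finite_subset by blast+
  define J where "J = {(i, j). i < j \<and> (i \<in> A \<and> j \<in> B \<or> i \<in> B \<and> j \<in> A)}"
  define I where "I = {(i, j). 1 \<le> i \<and> i < j \<and> j \<le> n}"
  have finI: "finite I" by (rule finite_subset[of _ "{1..n} \<times> {1..n}"]) (auto simp: I_def)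
  have JI: "J \<subseteq> I" using A B by (auto simp: J_def I_def)
  then have finJ: "finite J" using finI finite_subset by blast
  define M where "M = Pi_pmf I False (\<lambda>_. bernoulli_pmf (1/2))"
  define X :: "nat \<times> nat \<Rightarrow> (nat \<times> nat \<Rightarrow> bool) \<Rightarrow> real" where "X p x = of_bool (x p = (fst p \<in> A))" for p x
  note card = card_arcs_tournament_of_coins[OF A B disj, folded J_def]
  have cJ: "card J > 0" using card(2) False fin by (simp add: card_gt_0_iff)
  have exp: "measure_pmf.expectation M (X p) = 1/2" if "p \<in> J" for p
    using expectation_coin_eq[OF finI, of p False "fst p \<in> A"] that JI unfolding M_def X_def by blast
  interpret Hoeffding_ineq "measure_pmf M" J X "\<lambda>_. 0" "\<lambda>_. 1" "real (card J) / 2"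
  proof unfold_locales
    have "prob_space.indep_vars (measure_pmf M) (\<lambda>_. count_space UNIV) (\<lambda>p x. x p) J"
      unfolding M_def by (rule prob_space.indep_vars_subset[OF measure_pmf.prob_space_axioms indep_vars_Pi_pmf[OF finI] JI])
    then show "prob_space.indep_vars (measure_pmf M) (\<lambda>_. borel) X J"
      unfolding X_def by (rule prob_space.indep_vars_compose2[OF measure_pmf.prob_space_axioms]) simp
    show "real (card J) / 2 \<equiv> \<Sum>p\<in>J. measure_pmf.expectation M (X p)"
      by (intro eq_reflection) (simp add: exp)
  qed (auto simp: finJ X_def)
  have "measure_pmf.prob (random_tournament n)
      {T. real (card (parcs T \<inter> A \<times> B)) < real (card A) * real (card B) / 2 - t} =
      measure_pmf.prob M {x. (\<Sum>p\<in>J. X p x) < real (card J) / 2 - t}"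
    unfolding random_tournament_def I_def[symmetric] M_def[symmetric] by (simp add: card X_def vimage_def)
  also have "\<dots> \<le> measure_pmf.prob M {x. (\<Sum>p\<in>J. X p x) \<le> real (card J) / 2 - t}"
    by (intro measure_pmf.finite_measure_mono) auto
  also have "\<dots> \<le> exp (- 2 * t\<^sup>2 / real (card J))"
    using Hoeffding_ineq_le[OF t] cJ by simp
  also have "\<dots> \<le> exp (- 2 * t\<^sup>2 / N)"
  proof -
    have "real (card J) \<le> N" using N card(2) by simp
    then have "2 * t\<^sup>2 / N \<le> 2 * t\<^sup>2 / real (card J)"
      using cJ by (intro divide_left_mono) auto
    then show ?thesis by simp
  qed
  finally show ?thesis .
qed

section \<open>Quasirandomness of the random tournament\<close>

lemma pverts_random_tournament: "T \<in> set_pmf (random_tournament n) \<Longrightarrow> pverts T = {1..n}"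
  by (auto simp: random_tournament_def tournament_of_coins_def)

lemma measure_pmf_tendsto_1I:
  assumes "\<forall>\<^sub>F n in sequentially. 1 - g n \<le> measure_pmf.prob (M n) (S n)" and "g \<longlonglongrightarrow> 0"
  shows "(\<lambda>n. measure_pmf.prob (M n) (S n)) \<longlonglongrightarrow> 1"
proof (rule tendsto_sandwich[of "\<lambda>n. 1 - g n" _ _ "\<lambda>_. 1"])
  show "(\<lambda>n. 1 - g n) \<longlonglongrightarrow> 1" using tendsto_diff[OF tendsto_const assms(2), of 1] by simp
qed (use assms(1) in auto)

text \<open>There are at most \<open>4 ^ n\<close> pairs of sets, while each fails with probability
  exponentially small in the square of \<open>n\<close>.\<close>

lemma quasirandom_random_tournament:
  assumes \<eta>: "\<eta> > 0"
  shows "(\<lambda>n. measure_pmf.prob (random_tournament n) {T. quasirandom \<eta> T}) \<longlonglongrightarrow> 1"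
proof (rule measure_pmf_tendsto_1I, rule always_eventually, rule allI)
  fix n
  let ?M = "measure_pmf (random_tournament n)"
  define S where "S = {(A, B). A \<subseteq> {1..n} \<and> B \<subseteq> {1..n} \<and> A \<inter> B = {}}"
  define bad where "bad = (\<lambda>(A, B). {T :: nat pair_pre_digraph. real (card (parcs T \<inter> A \<times> B)) < real (card A) * real (card B) / 2 - \<eta> * (real n)\<^sup>2})"
  have sub: "S \<subseteq> Pow {1..n} \<times> Pow {1..n}" by (auto simp: S_def)
  then have finS: "finite S" by (rule finite_subset) simp
  have cS: "card S \<le> 4 ^ n"
    using card_mono[OF _ sub] by (simp add: card_cartesian_product card_Pow flip: power_mult_distrib)
  have "1 - measure ?M {T. quasirandom \<eta> T} = measure ?M (- {T. quasirandom \<eta> T})"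
    by (simp add: measure_pmf.prob_compl[symmetric] Compl_eq_Diff_UNIV)
  also have "\<dots> \<le> measure ?M (\<Union>s\<in>S. bad s)"
  proof (rule measure_pmf.finite_measure_mono_AE)
    \<comment> \<open>The vertex set is \<open>{1..n}\<close> on the support of the distribution, so
      the inclusion of events is shown almost surely.\<close>
    show "AE T in ?M. T \<in> - {T. quasirandom \<eta> T} \<longrightarrow> T \<in> (\<Union>s\<in>S. bad s)"
      unfolding AE_measure_pmf_iff
    proof (intro ballI impI)
      fix T assume T: "T \<in> set_pmf (random_tournament n)" "T \<in> - {T. quasirandom \<eta> T}"
      have V: "pverts T = {1..n}" using T(1) by (rule pverts_random_tournament)
      from T(2) obtain A B where "(A, B) \<in> S" "T \<in> bad (A, B)"
        unfolding S_def bad_def by (auto simp: quasirandom_def V not_le)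
      then show "T \<in> (\<Union>s\<in>S. bad s)" by blast
    qed
  qed auto
  also have "\<dots> \<le> (\<Sum>s\<in>S. measure ?M (bad s))"
    by (rule measure_pmf.finite_measure_subadditive_finite) (use finS in auto)
  also have "\<dots> \<le> (\<Sum>s\<in>S. exp (- 2 * \<eta>\<^sup>2 * (real n)\<^sup>2))"
  proof (rule sum_mono)
    fix s assume "s \<in> S"
    then obtain A B where s: "s = (A, B)" and AB: "A \<subseteq> {1..n}" "B \<subseteq> {1..n}" "A \<inter> B = {}"
      by (auto simp: S_def)
    have "card A \<le> n" "card B \<le> n"
      using card_mono[OF _ AB(1)] card_mono[OF _ AB(2)] by auto
    then have "real (card A * card B) \<le> (real n)\<^sup>2"
      by (simp add: power2_eq_square mult_mono)
    from prob_few_arcs_le[OF AB _ this, of "\<eta> * (real n)\<^sup>2"] \<eta>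
    have "measure ?M (bad s) \<le> exp (- 2 * (\<eta> * (real n)\<^sup>2)\<^sup>2 / (real n)\<^sup>2)" by (simp add: bad_def s)
    also have "- 2 * (\<eta> * (real n)\<^sup>2)\<^sup>2 / (real n)\<^sup>2 = - 2 * \<eta>\<^sup>2 * (real n)\<^sup>2"
      by (cases "n = 0") (simp_all add: power2_eq_square)
    finally show "measure ?M (bad s) \<le> exp (- 2 * \<eta>\<^sup>2 * (real n)\<^sup>2)" .
  qed
  also have "\<dots> \<le> real (4 ^ n) * exp (- 2 * \<eta>\<^sup>2 * (real n)\<^sup>2)"
    unfolding sum_constant using cS by (intro mult_right_mono) (simp_all flip: of_nat_le_iff)
  finally show "1 - 4 ^ n * exp (- 2 * \<eta>\<^sup>2 * (real n)\<^sup>2) \<le> measure ?M {T. quasirandom \<eta> T}" by simp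
next
  show "(\<lambda>n. 4 ^ n * exp (- 2 * \<eta>\<^sup>2 * (real n)\<^sup>2)) \<longlonglongrightarrow> 0"
    using \<eta> by real_asymp
qed

lemma f_depth_2_random_tournament:
  assumes k: "k \<ge> 1"
  shows "\<exists>c>0. (\<lambda>n. measure_pmf.prob (random_tournament n)
             {T. real (f_depth T k 2) \<ge> (c + 1/2) * real n}) \<longlonglongrightarrow> 1"
proof -
  define \<delta> where "\<delta> = 1 / (4 * real k * 2 ^ k)"
  have \<delta>: "\<delta> > 0" using k by (simp add: \<delta>_def)
  let ?Q = "\<lambda>n. measure_pmf.prob (random_tournament n) {T. quasirandom (\<delta>\<^sup>2 / 8) T}"
  let ?P = "\<lambda>n. measure_pmf.prob (random_tournament n) {T. real (f_depth T k 2) \<ge> (\<delta> / 4 + 1/2) * real n}"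
  have "?P \<longlonglongrightarrow> 1"
  proof (rule tendsto_sandwich[of ?Q _ _ "\<lambda>_. 1"])
    show "?Q \<longlonglongrightarrow> 1" using \<delta> by (intro quasirandom_random_tournament) simp
    show "\<forall>\<^sub>F n in sequentially. ?Q n \<le> ?P n"
    proof (rule eventually_mono[OF eventually_gt_at_top[of "2 ^ (k + 1)"]])
      fix n :: nat assume n: "n > 2 ^ (k + 1)"
      show "?Q n \<le> ?P n"
      proof (rule measure_pmf.finite_measure_mono_AE)
        show "AE T in measure_pmf (random_tournament n). T \<in> {T. quasirandom (\<delta>\<^sup>2 / 8) T} \<longrightarrow>
            T \<in> {T. real (f_depth T k 2) \<ge> (\<delta> / 4 + 1/2) * real n}"
          unfolding AE_measure_pmf_iff
        proof (intro ballI impI CollectI, elim CollectE)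
          fix T assume T: "T \<in> set_pmf (random_tournament n)" "quasirandom (\<delta>\<^sup>2 / 8) T"
          have "n = card (pverts T)" using pverts_random_tournament[OF T(1)] by simp
          from f_depth_2_ge[OF tournament_random_tournament[OF T(1)] k this n \<delta>_def T(2)]
          show "real (f_depth T k 2) \<ge> (\<delta> / 4 + 1/2) * real n" .
        qed
      qed simp
    qed
  qed auto
  then show ?thesis using \<delta> by (intro exI[of _ "\<delta> / 4"]) auto
qed

section \<open>Colourings from antichains\<close>

text \<open>The indices stand for the parts, that is, the residues modulo \<open>m\<close>. Below
  \<open>K = k - 1\<close>, which reserves one colour for arcs inside parts.\<close>

definition antichain_family :: "nat \<Rightarrow> nat \<Rightarrow> (nat \<Rightarrow> nat set) \<Rightarrow> bool" where
  "antichain_family m K S \<longleftrightarrow> (\<forall>i<m. S i \<subseteq> {1..K}) \<and> (\<forall>i<m. \<forall>j<m. i \<noteq> j \<longrightarrow> \<not> S i \<subseteq> S j)"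

text \<open>Each old label is extended in \<open>d\<close> ways by one of \<open>d\<close> new
  elements. Extensions of different labels are separated by an old element, those of the same label
  by the new ones.\<close>

lemma antichain_family_extend:
  assumes "\<exists>S. antichain_family m K S"
  shows "\<exists>S. antichain_family (d * m) (K + d) S"
proof -
  obtain S where S: "\<And>i. i < m \<Longrightarrow> S i \<subseteq> {1..K}" "\<And>i j. i < m \<Longrightarrow> j < m \<Longrightarrow> i \<noteq> j \<Longrightarrow> \<not> S i \<subseteq> S j"
    using assms unfolding antichain_family_def by blast
  define S' where "S' i = insert (Suc (K + i mod d)) (S (i div d))" for i
  have lt: "i div d < m" "i mod d < d" if "i < d * m" for i
  proof -
    have "d > 0" using that by (cases d) auto
    then show "i mod d < d" by simp
    show "i div d < m" using that by (simp add: less_mult_imp_div_less mult.commute)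
  qed
  have "S' i \<subseteq> {1..K + d}" if "i < d * m" for i
    using S(1)[OF lt(1)[OF that]] lt(2)[OF that] by (auto simp: S'_def)
  moreover have "\<not> S' i \<subseteq> S' j" if ij: "i < d * m" "j < d * m" "i \<noteq> j" for i j
  proof (cases "i div d = j div d")
    case True
    then have "i mod d \<noteq> j mod d" using ij(3) by (metis div_mult_mod_eq)
    then have "Suc (K + i mod d) \<in> S' i - S' j"
      using S(1)[OF lt(1)[OF ij(2)]] by (auto simp: S'_def)
    then show ?thesis by blast
  next
    case False
    then obtain x where x: "x \<in> S (i div d)" "x \<notin> S (j div d)"
      using S(2)[OF lt(1)[OF ij(1)] lt(1)[OF ij(2)]] by blast
    then have "x \<le> K" using S(1)[OF lt(1)[OF ij(1)]] by auto
    then have "x \<in> S' i - S' j" using x by (auto simp: S'_def)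
    then show ?thesis by blast
  qed
  ultimately have "antichain_family (d * m) (K + d) S'" by (simp add: antichain_family_def)
  then show ?thesis by blast
qed

lemma antichain_family_power3:
  assumes "\<exists>S. antichain_family m K S"
  shows "\<exists>S. antichain_family (3 ^ j * m) (K + 3 * j) S"
proof (induction j)
  case 0
  then show ?case using assms by simp
next
  case (Suc j)
  from antichain_family_extend[OF this, of 3] show ?case by (simp add: algebra_simps)
qed

text \<open>The \<open>k - 1\<close> colours are split into groups of three, with one group of two
  for residue 0 and two groups of two for residue 2. Labels take one colour from each group, so
  \<open>m\<close> is the product of the group sizes: \<open>2 * 3 ^ j\<close>, \<open>3 ^ j\<close>
  or \<open>4 * 3 ^ j\<close>.\<close>

lemma ex_antichain_family:
  assumes k: "k \<ge> 3"
  shows "\<exists>m>0. (\<exists>S. antichain_family m (k - 1) S) \<and> 1/2 + 1 / (2 * real m) =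
      (if k mod 3 = 0 then 1/2 + 1 / (4 * 3 powr (real k / 3 - 1))
       else if k mod 3 = 1 then 1/2 + 1 / (2 * 3 powr ((real k - 1) / 3))
       else 1/2 + 1 / (8 * 3 powr ((real k - 5) / 3)))"
proof -
  have 1: "\<exists>S. antichain_family 1 0 S"
    by (intro exI[of _ "\<lambda>_. {}"]) (simp add: antichain_family_def)
  have 2: "\<exists>S. antichain_family 2 2 S"
    using antichain_family_extend[OF 1, of 2] by (simp add: numeral_2_eq_2)
  have 4: "\<exists>S. antichain_family 4 4 S"
    using antichain_family_extend[OF 2, of 2] by simp
  consider "k mod 3 = 0" | "k mod 3 = 1" | "k mod 3 = 2" by linarith
  then show ?thesis
  proof cases
    case 1
    then obtain j where "k = 3 * j" by auto
    then obtain j where j: "k = 3 * Suc j" using k by (cases j) auto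
    have "k - 1 = 2 + 3 * j" using j by simp
    then have "\<exists>S. antichain_family (3 ^ j * 2) (k - 1) S" using antichain_family_power3[OF 2, of j] by simp
    moreover have "real k / 3 - 1 = real j" using j by (simp add: field_simps)
    then have "3 powr (real k / 3 - 1) = 3 ^ j" by (simp add: powr_realpow)
    ultimately show ?thesis using 1 by (intro exI[of _ "3 ^ j * 2"]) simp
  next
    case 2
    define j where "j = k div 3"
    have j: "k = 3 * j + 1" using 2 unfolding j_def by presburger
    then have "\<exists>S. antichain_family (3 ^ j) (k - 1) S"
      using antichain_family_power3[OF \<open>\<exists>S. antichain_family 1 0 S\<close>, of j] by simp
    moreover have "(real k - 1) / 3 = real j" using j by simp
    then have "3 powr ((real k - 1) / 3) = 3 ^ j" by (simp add: powr_realpow)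
    ultimately show ?thesis using 2 by (intro exI[of _ "3 ^ j"]) simp
  next
    case 3
    \<comment> \<open>Residue 2 and \<open>k \<ge> 3\<close> force \<open>k \<ge> 5\<close>, so the
      subtraction does not truncate.\<close>
    define j where "j = k div 3 - 1"
    have j: "k = 3 * j + 5" using 3 k unfolding j_def by presburger
    then have "k - 1 = 4 + 3 * j" by simp
    then have "\<exists>S. antichain_family (3 ^ j * 4) (k - 1) S" using antichain_family_power3[OF 4, of j] by simp
    moreover have "(real k - 5) / 3 = real j" using j by simp
    then have "3 powr ((real k - 5) / 3) = 3 ^ j" by (simp add: powr_realpow)
    ultimately show ?thesis using 3 by (intro exI[of _ "3 ^ j * 4"]) simp
  qed
qed

section \<open>Reach of a root under a colouring by parts\<close>

text \<open>Every arc of a monochromatic walk with at least two arcs is adjacent to another of its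
  colour, so it stays inside its part under \<open>\<pi>\<close>.\<close>

lemma mono_walk_stays_in_part:
  assumes mono2: "\<And>u v w. (u, v) \<in> E \<Longrightarrow> (v, w) \<in> E \<Longrightarrow> c (u, v) = c (v, w) \<Longrightarrow> \<pi> u = \<pi> v \<and> \<pi> v = \<pi> w"
    and "pcas u p v" "set p \<subseteq> E" "\<forall>e\<in>set p. c e = x" "length p \<ge> 2"
  shows "\<pi> v = \<pi> u"
  using assms(2-)
proof (induction p arbitrary: u)
  case (Cons e p)
  then obtain e' q where p: "p = e' # q" by (cases p) auto
  have "\<pi> u = \<pi> (snd e) \<and> \<pi> (snd e) = \<pi> (snd e')"
    using Cons.prems mono2[of u "snd e" "snd e'"] unfolding p by (cases e; cases e') auto
  moreover have "\<pi> v = \<pi> (snd e)" if "q \<noteq> []"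
    using Cons.IH[of "snd e"] Cons.prems that by (auto simp: p Suc_le_eq)
  moreover have "v = snd e'" if "q = []" using Cons.prems that by (auto simp: p)
  ultimately show ?case by auto
qed simp

text \<open>A monochromatic path from the root \<open>r\<close> is empty, a single arc, or confined
  to the part of \<open>r\<close>. Hence a tree lies within that part and the out-neighbourhood of
  \<open>r\<close>.\<close>

lemma f_unbounded_le:
  assumes T: "tournament T" and ne: "pverts T \<noteq> {}" and c: "edge_coloring k T c"
    and mono2: "\<And>u v w. (u, v) \<in> parcs T \<Longrightarrow> (v, w) \<in> parcs T \<Longrightarrow> c (u, v) = c (v, w) \<Longrightarrow> \<pi> u = \<pi> v \<and> \<pi> v = \<pi> w"
  shows "\<exists>r\<in>pverts T. f_unbounded T k \<le>
    card {v \<in> pverts T. \<pi> v \<noteq> \<pi> r \<and> (r, v) \<in> parcs T} + card {v \<in> pverts T. \<pi> v = \<pi> r}"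
proof -
  interpret T: pair_digraph T using T by (rule tournament_pair_digraph)
  let ?P = "\<lambda>m. \<forall>c. edge_coloring k T c \<longrightarrow>
     (\<exists>H r. subgraph (with_proj H) (with_proj T) \<and> arborescence H r \<and> path_monochromatic c H \<and>
        m \<le> card (pverts H))"
  \<comment> \<open>One-vertex trees make the predicate satisfiable; together with
    \<open>bound\<close> this guarantees that \<open>GREATEST\<close> is attained.\<close>
  have "?P 0"
  proof (intro allI impI)
    fix c
    obtain r where r: "r \<in> pverts T" using ne by blast
    let ?H = "parent_digraph {r} r id"
    have "pair_digraph ?H" "arborescence ?H r"
      using pair_digraph_parent_digraph[of "{r}" r] arborescence_parent_digraph[of "{r}" r] by auto
    moreover have "subgraph (with_proj ?H) (with_proj T)"
      using T.pair_digraph \<open>pair_digraph ?H\<close> by (rule subgraph_parent_digraph) (use r in auto)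
    moreover have "path_monochromatic c ?H"
      by (rule path_monochromatic_parent_digraph) auto
    ultimately show "\<exists>H r. subgraph (with_proj H) (with_proj T) \<and> arborescence H r \<and> path_monochromatic c H \<and>
        0 \<le> card (pverts H)" by blast
  qed
  moreover have bound: "m \<le> card (pverts T)" if P: "?P m" for m
  proof -
    from P[rule_format, OF c]
    obtain H where H: "subgraph (with_proj H) (with_proj T)" "m \<le> card (pverts H)" by blast
    then have "pverts H \<subseteq> pverts T" by (simp add: subgraph_def)
    from card_mono[OF T.pair_finite_verts this] show ?thesis using H(2) by linarith
  qed
  ultimately have "?P (f_unbounded T k)" unfolding f_unbounded_def by (rule GreatestI_nat)
  from this[rule_format, OF c] obtain H r where sub: "subgraph (with_proj H) (with_proj T)"
    and H: "arborescence H r" "path_monochromatic c H" and le: "f_unbounded T k \<le> card (pverts H)"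
    by blast
  have VH: "pverts H \<subseteq> pverts T" and EH: "parcs H \<subseteq> parcs T" using sub by (auto simp: subgraph_def)
  have rT: "r \<in> pverts T" using H(1) VH by (auto simp: arborescence_def)
  let ?N = "{v \<in> pverts T. \<pi> v \<noteq> \<pi> r \<and> (r, v) \<in> parcs T}"
  let ?R = "{v \<in> pverts T. \<pi> v = \<pi> r}"
  have "pverts H \<subseteq> ?N \<union> ?R"
  proof
    fix v assume v: "v \<in> pverts H"
    then obtain p where p: "pre_digraph.apath (with_proj H) r p v"
      using H(1) by (auto simp: arborescence_def)
    then have cas: "pcas r p v" and arcs: "set p \<subseteq> parcs T"
      using EH by (auto simp: pre_digraph.apath_def pre_digraph.awalk_def cas_with_proj_eq)
    have mono: "\<forall>e\<in>set p. c e = c (hd p)"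
      using H(2)[unfolded path_monochromatic_def, rule_format, OF p] by (metis empty_iff hd_in_set list.set(1))
    consider "p = []" | e where "p = [e]" | "length p \<ge> 2"
      by (cases p rule: remdups_adj.cases) auto
    then have "\<pi> v = \<pi> r \<or> (r, v) \<in> parcs T"
    proof cases
      case 3
      then show ?thesis using mono_walk_stays_in_part[of "parcs T" c \<pi>, OF mono2 cas arcs mono] by blast
    qed (use cas arcs in auto)
    then show "v \<in> ?N \<union> ?R" using v VH by auto
  qed
  then have "card (pverts H) \<le> card (?N \<union> ?R)" using T.pair_finite_verts by (intro card_mono) auto
  also have "\<dots> \<le> card ?N + card ?R" by (rule card_Un_le)
  finally show ?thesis using le rT by (intro bexI[of _ r]) auto
qed

text \<open>
  Colour \<open>i < k\<close> only leads from parts whose label contains \<open>i\<close> to parts whose label does not,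
  so no two consecutive arcs between parts have the same colour; colour \<open>k\<close> stays inside parts.
\<close>

lemma ex_antichain_coloring:
  assumes S: "antichain_family m (k - 1) S" and k: "k \<ge> 1" and m: "m > 0"
  obtains c where "edge_coloring k T c"
    "\<And>u v w. c (u, v) = c (v, w) \<Longrightarrow> u mod m = v mod m \<and> v mod m = w mod m"
proof -
  \<comment> \<open>The choice is from a nonempty set, since distinct parts have incomparable
    labels.\<close>
  define c where "c = (\<lambda>(u, v). if u mod m = v mod m then k else SOME i. i \<in> S (u mod m) - S (v mod m))"
  have c_in: "c (u, v) \<in> S (u mod m) - S (v mod m)" if "u mod m \<noteq> v mod m" for u v
  proof -
    have "\<exists>i. i \<in> S (u mod m) - S (v mod m)"
      using S that mod_less_divisor[OF m] unfolding antichain_family_def by blast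
    from someI_ex[OF this] show ?thesis using that by (simp add: c_def)
  qed
  have Sub: "S (u mod m) \<subseteq> {1..k - 1}" for u using S m by (simp add: antichain_family_def)
  have c_less: "c (u, v) \<in> {1..<k}" if "u mod m \<noteq> v mod m" for u v
    using c_in[OF that] Sub[of u] k by force
  have c_eq: "c (u, v) = k" if "u mod m = v mod m" for u v using that by (simp add: c_def)
  have "c (u, v) \<in> {1..k}" for u v
    using c_less[of u v] c_eq[of u v] k by (cases "u mod m = v mod m") auto
  then have "edge_coloring k T c" by (auto simp: edge_coloring_def)
  moreover have "u mod m = v mod m \<and> v mod m = w mod m" if "c (u, v) = c (v, w)" for u v w
    using c_in[of u v] c_in[of v w] c_less[of u v] c_less[of v w] c_eq[of u v] c_eq[of v w] that by force
  ultimately show ?thesis using that by blast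
qed

text \<open>Division by \<open>m\<close> is injective on a residue class and takes values from 0 to
  \<open>n div m\<close>.\<close>

lemma card_residue_class_le:
  assumes m: "m > 0"
  shows "real (card {u \<in> {1..n}. u mod m = i}) \<le> real n / real m + 1"
proof -
  have "inj_on (\<lambda>u. u div m) {u \<in> {1..n}. u mod m = i}"
    by (rule inj_onI) (metis (mono_tags, lifting) div_mult_mod_eq mem_Collect_eq)
  moreover have "(\<lambda>u. u div m) ` {u \<in> {1..n}. u mod m = i} \<subseteq> {..n div m}"
    by (auto intro: div_le_mono)
  ultimately have "card {u \<in> {1..n}. u mod m = i} \<le> card {..n div m}"
    by (rule card_inj_on_le) simp
  also have "\<dots> = n div m + 1" by simp
  finally have "real (card {u \<in> {1..n}. u mod m = i}) \<le> real (n div m) + 1" by simp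
  also have "real (n div m) \<le> real n / real m" by (rule of_nat_div_le_of_nat)
  finally show ?thesis by simp
qed

text \<open>A union bound over the \<open>n\<close> possible roots suffices, as the colouring
  depends on residues and the choice of labels, not on large sets of vertices.\<close>

lemma prob_f_unbounded_le:
  assumes S: "antichain_family m (k - 1) S" and k: "k \<ge> 1" and m: "m > 0" and n: "n > 0" and \<eta>: "\<eta> \<ge> 0"
  shows "1 - real n * exp (- 2 * \<eta>\<^sup>2 * real n) \<le> measure_pmf.prob (random_tournament n)
    {T. real (f_unbounded T k) / real n - (\<eta> + 1 / real n) \<le> 1/2 + 1 / (2 * real m)}" (is "_ \<le> measure_pmf.prob _ ?G")
proof -
  let ?M = "measure_pmf (random_tournament n)"
  define A where "A r = {u \<in> {1..n}. u mod m \<noteq> r mod m}" for r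
  define R where "R r = {u \<in> {1..n}. u mod m = r mod m}" for r
  \<comment> \<open>Many arcs into \<open>r\<close> from the other parts mean few arcs out of it, so
    a lower tail bound with the singleton \<open>{r}\<close> controls the out-degree.\<close>
  define bad where "bad r = {T :: nat pair_pre_digraph. real (card (parcs T \<inter> A r \<times> {r})) < real (card (A r)) * real (card {r}) / 2 - \<eta> * real n}" for r
  have "1 - measure ?M ?G = measure ?M (- ?G)"
    by (simp only: measure_pmf.prob_compl[symmetric] Compl_eq_Diff_UNIV space_measure_pmf sets_measure_pmf UNIV_I)
  also have "\<dots> \<le> measure ?M (\<Union>r\<in>{1..n}. bad r)"
  proof (rule measure_pmf.finite_measure_mono_AE)
    show "AE T in ?M. T \<in> - ?G \<longrightarrow> T \<in> (\<Union>r\<in>{1..n}. bad r)"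
      unfolding AE_measure_pmf_iff
    proof (intro ballI impI, rule ccontr)
      fix T assume T_in: "T \<in> set_pmf (random_tournament n)" and "T \<in> - ?G" and good: "T \<notin> (\<Union>r\<in>{1..n}. bad r)"
      have T: "tournament T" and V: "pverts T = {1..n}"
        using tournament_random_tournament[OF T_in] pverts_random_tournament[OF T_in] .
      obtain c where c: "edge_coloring k T c"
        "\<And>u v w. c (u, v) = c (v, w) \<Longrightarrow> u mod m = v mod m \<and> v mod m = w mod m"
        using ex_antichain_coloring[OF S k m] by blast
      have "pverts T \<noteq> {}" using n V by simp
      from f_unbounded_le[OF T this c(1), of "\<lambda>v. v mod m", OF c(2)]
      obtain r where r: "r \<in> {1..n}" and le: "f_unbounded T k \<le>
          card {v \<in> {1..n}. v mod m \<noteq> r mod m \<and> (r, v) \<in> parcs T} + card (R r)"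
        unfolding V R_def by blast
      define Out where "Out = {v \<in> A r. (r, v) \<in> parcs T}"
      define In where "In = {v \<in> A r. (v, r) \<in> parcs T}"
      have finA: "finite Out" "finite In" by (auto simp: Out_def In_def A_def)
      have "(r, v) \<in> parcs T \<or> (v, r) \<in> parcs T" if "v \<in> A r" for v
      proof -
        have "v \<in> pverts T" "r \<in> pverts T" "r \<noteq> v" using that r V by (auto simp: A_def)
        then show ?thesis using tournament_arc_iff[OF T, of r v] by blast
      qed
      then have "A r = Out \<union> In" by (auto simp: Out_def In_def)
      moreover have "Out \<inter> In = {}" using tournament_asym[OF T] by (auto simp: Out_def In_def)
      ultimately have "card (A r) = card Out + card In"
        using card_Un_disjoint[of Out In] finA by simp
      moreover have "card In = card (parcs T \<inter> A r \<times> {r})"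
      proof -
        have "parcs T \<inter> A r \<times> {r} = (\<lambda>v. (v, r)) ` In" by (auto simp: In_def)
        then show ?thesis by (simp add: card_image inj_on_def)
      qed
      moreover have "real (card (A r)) / 2 - \<eta> * n \<le> card (parcs T \<inter> A r \<times> {r})"
        using good r by (auto simp: bad_def not_less)
      ultimately have out: "real (card Out) \<le> real (card (A r)) / 2 + \<eta> * n" by linarith
      have "card (A r \<union> R r) = card (A r) + card (R r)"
        by (intro card_Un_disjoint) (auto simp: A_def R_def)
      moreover have "A r \<union> R r = {1..n}" by (auto simp: A_def R_def)
      ultimately have "card {1..n} = card (A r) + card (R r)" by simp
      then have nAR: "real n = real (card (A r)) + real (card (R r))" by simp
      have "{v \<in> {1..n}. v mod m \<noteq> r mod m \<and> (r, v) \<in> parcs T} = Out" by (auto simp: Out_def A_def)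
      then have "real (f_unbounded T k) \<le> real (card Out) + real (card (R r))" using le by simp
      \<comment> \<open>Half of the other parts plus the whole of the root's own part is half of all
        vertices plus half of that part.\<close>
      also have "\<dots> \<le> n / 2 + card (R r) / 2 + \<eta> * n" using out nAR by (simp add: field_simps)
      also have "\<dots> \<le> n / 2 + (n / m + 1) / 2 + \<eta> * n"
        using card_residue_class_le[OF m, of n "r mod m"] by (simp add: R_def)
      finally have "real (f_unbounded T k) / n \<le> (n / 2 + (n / m + 1) / 2 + \<eta> * n) / n"
        by (rule divide_right_mono) simp
      also have "\<dots> \<le> 1/2 + 1 / (2 * real m) + (\<eta> + 1 / n)"
        using n m by (simp add: field_simps)
      finally show False using \<open>T \<in> - ?G\<close> by simp
    qed
  qed auto
  also have "\<dots> \<le> (\<Sum>r\<in>{1..n}. measure ?M (bad r))"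
    by (rule measure_pmf.finite_measure_subadditive_finite) auto
  also have "\<dots> \<le> (\<Sum>r\<in>{1..n}. exp (- 2 * \<eta>\<^sup>2 * real n))"
  proof (rule sum_mono)
    fix r assume r: "r \<in> {1..n}"
    have A: "A r \<subseteq> {1..n}" "A r \<inter> {r} = {}" by (auto simp: A_def)
    have "real (card (A r) * card {r}) \<le> n" using card_mono[OF _ A(1)] by simp
    from prob_few_arcs_le[OF A(1) _ A(2) _ this, of "\<eta> * n"] r \<eta>
    have "measure ?M (bad r) \<le> exp (- 2 * (\<eta> * n)\<^sup>2 / n)" by (simp add: bad_def)
    also have "- 2 * (\<eta> * n)\<^sup>2 / n = - 2 * \<eta>\<^sup>2 * n" using n by (simp add: power2_eq_square)
    finally show "measure ?M (bad r) \<le> exp (- 2 * \<eta>\<^sup>2 * real n)" .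
  qed
  finally show ?thesis by simp
qed

theorem theorem2:
  fixes k :: nat
  assumes "k \<ge> 3"
  shows "(\<exists>c>0. (\<lambda>n. measure_pmf.prob (random_tournament n)
             {T. real (f_depth T k 2) \<ge> (c + 1/2) * real n}) \<longlonglongrightarrow> 1) \<and>
         (\<exists>\<epsilon> :: nat \<Rightarrow> real. \<epsilon> \<longlonglongrightarrow> 0 \<and>
           (\<lambda>n. measure_pmf.prob (random_tournament n)
             {T. real (f_unbounded T k) / real n - \<epsilon> n \<le>
                (if k mod 3 = 0 then 1/2 + 1 / (4 * 3 powr (real k / 3 - 1))
                 else if k mod 3 = 1 then 1/2 + 1 / (2 * 3 powr ((real k - 1) / 3))
                 else 1/2 + 1 / (8 * 3 powr ((real k - 5) / 3)))}) \<longlonglongrightarrow> 1)"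
proof (rule conjI)
  show "\<exists>c>0. (\<lambda>n. measure_pmf.prob (random_tournament n)
             {T. real (f_depth T k 2) \<ge> (c + 1/2) * real n}) \<longlonglongrightarrow> 1"
    using assms by (intro f_depth_2_random_tournament) simp
next
  obtain m S where m: "m > 0" and S: "antichain_family m (k - 1) S"
    and bound: "1/2 + 1 / (2 * real m) =
      (if k mod 3 = 0 then 1/2 + 1 / (4 * 3 powr (real k / 3 - 1))
       else if k mod 3 = 1 then 1/2 + 1 / (2 * 3 powr ((real k - 1) / 3))
       else 1/2 + 1 / (8 * 3 powr ((real k - 5) / 3)))"
    using ex_antichain_family[OF assms] by blast
  \<comment> \<open>The error tends to 0, yet \<open>(\<eta> n)\<^sup>2 * n\<close> is the square
    root of \<open>n\<close>, which lets the exponential beat the \<open>n\<close> terms of the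
    union bound.\<close>
  define \<eta> where "\<eta> n = real n powr (- (1/4))" for n
  have "(\<lambda>n. \<eta> n + 1 / real n) \<longlonglongrightarrow> 0" unfolding \<eta>_def by real_asymp
  moreover have "(\<lambda>n. measure_pmf.prob (random_tournament n)
      {T. real (f_unbounded T k) / real n - (\<eta> n + 1 / real n) \<le> 1/2 + 1 / (2 * real m)}) \<longlonglongrightarrow> 1"
  proof (rule measure_pmf_tendsto_1I)
    show "\<forall>\<^sub>F n in sequentially. 1 - real n * exp (- 2 * (\<eta> n)\<^sup>2 * real n) \<le> measure_pmf.prob (random_tournament n)
      {T. real (f_unbounded T k) / real n - (\<eta> n + 1 / real n) \<le> 1/2 + 1 / (2 * real m)}"
      using eventually_gt_at_top[of 0]
    proof eventually_elim
      case (elim n)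
      then show ?case using assms by (intro prob_f_unbounded_le[OF S _ m]) (auto simp: \<eta>_def)
    qed
    show "(\<lambda>n. real n * exp (- 2 * (\<eta> n)\<^sup>2 * real n)) \<longlonglongrightarrow> 0"
      unfolding \<eta>_def by real_asymp
  qed
  ultimately show "\<exists>\<epsilon> :: nat \<Rightarrow> real. \<epsilon> \<longlonglongrightarrow> 0 \<and>
           (\<lambda>n. measure_pmf.prob (random_tournament n)
             {T. real (f_unbounded T k) / real n - \<epsilon> n \<le>
                (if k mod 3 = 0 then 1/2 + 1 / (4 * 3 powr (real k / 3 - 1))
                 else if k mod 3 = 1 then 1/2 + 1 / (2 * 3 powr ((real k - 1) / 3))
                 else 1/2 + 1 / (8 * 3 powr ((real k - 5) / 3)))}) \<longlonglongrightarrow> 1"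
    unfolding bound by blast
qed

end
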